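(* Let $G$ be a finite group acting by affine maps on $\mathbb{R}^m$ and on $\mathbb{R}^d$. Let $P \subseteq \mathbb{R}^m$ be a $G$-polytope and let $Q \subseteq \mathbb{R}^d$ be a $G$-polytope which, together with a linear map $p\colon \mathbb{R}^d \to \mathbb{R}^m$, is a symmetric extension of $P$. Let $X$ be the vertex set of $P$. For every facet $j$ of $Q$ let $\mathcal{F}_j$ be a refinement of the partition of $X$ into $\operatorname{Stab}_G(j)$-orbits. Then for every family of real numbers $(c_x)_{x \in X}$ satisfying \[ \sum_{x \in X} c_x = 1, \qquad \sum_{x \in F} c_x \ge 0 \quad \text{for all } F \in \mathcal{F}_j \text{ and all facets } j \text{ of } Q, \] the point $\sum_{x \in X} c_x x$ lies in $P$.
   Context: A $G$-polytope is a polytope $P$ with $gP = P$ for all $g \in G$ (for an affine action of $G$). A symmetric extension of a $G$-polytope $P \subseteq \mathbb{R}^m$ is a $G$-polytope $Q \subseteq \mathbb{R}^d$ together with a linear map $p\colon\mathbb{R}^d\to\mathbb{R}^m$ (maps written on the right) such that $Qp = P$ and $g(xp) = (gx)p$ for all $g \in G$, $x \in Q$. The group $G$ permutes the facets of $Q$ and the vertices of $P$; $\operatorname{Stab}_G(j)=\{g\in G : gj=j\}$ is the stabilizer of the facet $j$. A refinement of a partition of $X$ is a partition of $X$ each of whose blocks is contained in a block of the given partition. *)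

theory Defs
  imports "HOL-Analysis.Analysis" "HOL-Algebra.Group_Action"
begin

definition affine_map :: "('a::real_vector \<Rightarrow> 'b::real_vector) \<Rightarrow> bool" where
  "affine_map f \<longleftrightarrow> (\<exists>L b. linear L \<and> (\<forall>x. f x = L x + b))"

definition affine_action ::
    "('g, 'r) monoid_scheme \<Rightarrow> ('g \<Rightarrow> 'a::real_vector \<Rightarrow> 'a) \<Rightarrow> bool" where
  "affine_action G \<phi> \<longleftrightarrow> group_action G UNIV \<phi> \<and> (\<forall>g\<in>carrier G. affine_map (\<phi> g))"

definition G_polytope ::
    "('g, 'r) monoid_scheme \<Rightarrow> ('g \<Rightarrow> 'a::real_vector \<Rightarrow> 'a) \<Rightarrow> 'a set \<Rightarrow> bool" where
  "G_polytope G \<phi> P \<longleftrightarrow> polytope P \<and> (\<forall>g\<in>carrier G. \<phi> g ` P = P)"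

definition symmetric_extension ::
    "('g, 'r) monoid_scheme \<Rightarrow> ('g \<Rightarrow> 'a::real_vector \<Rightarrow> 'a) \<Rightarrow> 'a set
      \<Rightarrow> ('g \<Rightarrow> 'b::real_vector \<Rightarrow> 'b) \<Rightarrow> 'b set \<Rightarrow> ('b \<Rightarrow> 'a) \<Rightarrow> bool" where
  "symmetric_extension G \<phi> P \<psi> Q p \<longleftrightarrow>
     G_polytope G \<phi> P \<and> G_polytope G \<psi> Q \<and> linear p \<and> p ` Q = P \<and>
     (\<forall>g\<in>carrier G. \<forall>x\<in>Q. \<phi> g (p x) = p (\<psi> g x))"

definition vertices :: "'a::real_vector set \<Rightarrow> 'a set" where
  "vertices P = {x. x extreme_point_of P}"

definition facet_stabilizer ::
    "('g, 'r) monoid_scheme \<Rightarrow> ('g \<Rightarrow> 'b \<Rightarrow> 'b) \<Rightarrow> 'b set \<Rightarrow> 'g set" where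
  "facet_stabilizer G \<psi> j = stabilizer G (\<lambda>g S. \<psi> g ` S) j"

end

theory Submission
  imports Defs
begin

text \<open>
  Averaging over \<open>G\<close> produces a \<open>G\<close>-equivariant section \<open>s : P \<rightarrow> Q\<close> of \<open>p\<close>. Averaging the slack
  function of a facet \<open>j\<close> over \<open>Stab\<^sub>G(j)\<close> gives an affine function that is nonnegative on \<open>Q\<close>,
  vanishes on \<open>j\<close> but not on the relative interior of \<open>Q\<close>, and is constant on the image under \<open>s\<close>
  of each \<open>Stab\<^sub>G(j)\<close>-orbit. So the assumptions on \<open>c\<close> make it nonnegative at
  \<open>y = (\<Sum>x\<in>X. c x *\<^sub>R s x)\<close>. This holds for all facets, whence \<open>y \<in> Q\<close>, and \<open>p y = (\<Sum>x\<in>X. c x *\<^sub>R x)\<close>.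
\<close>

section \<open>Affine maps and membership in a polytope\<close>

lemma affine_map_affine_combination:
  assumes "affine_map f" "sum c A = 1"
  shows "f (\<Sum>x\<in>A. c x *\<^sub>R s x) = (\<Sum>x\<in>A. c x *\<^sub>R f (s x))"
proof -
  obtain L b where L: "linear L" and f: "\<And>x. f x = L x + b"
    using assms(1) unfolding affine_map_def by blast
  show ?thesis
    using assms(2)
    by (simp add: f linear_sum[OF L] linear_cmul[OF L] scaleR_add_right sum.distrib
        flip: scaleR_sum_left)
qed

lemma affine_map_line:
  assumes "affine_map f"
  shows "f (x + t *\<^sub>R (y - x)) = (1 - t) *\<^sub>R f x + t *\<^sub>R f y"
proof -
  obtain L b where L: "linear L" and f: "\<And>x. f x = L x + b"
    using assms unfolding affine_map_def by blast
  show ?thesis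
    by (simp add: f linear_add[OF L] linear_cmul[OF L] linear_diff[OF L] algebra_simps)
qed

text \<open>For a facet with inequality \<open>a \<bullet> z \<le> b\<close> and stabilizer
  \<open>S\<close>, this sum is the averaged slack up to the factor \<open>card S\<close>.\<close>

lemma affine_map_sum_slack:
  fixes a :: "'a::real_inner"
  assumes "\<And>g. g \<in> S \<Longrightarrow> affine_map (\<psi> g :: 'b::real_vector \<Rightarrow> 'a)"
  shows "affine_map (\<lambda>z. \<Sum>g\<in>S. b - a \<bullet> \<psi> g z)"
proof -
  obtain L v where L: "\<And>g. g \<in> S \<Longrightarrow> linear (L g)"
    and \<psi>: "\<And>g z. g \<in> S \<Longrightarrow> \<psi> g z = L g z + v g"
    using assms unfolding affine_map_def by metis
  have "linear (\<lambda>z. \<Sum>g\<in>S. - (a \<bullet> L g z))"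
    by (intro linear_compose_sum ballI linear_compose_neg
        linear_compose[OF L bounded_linear.linear[OF bounded_linear_inner_right], unfolded o_def])
  moreover have "(\<Sum>g\<in>S. b - a \<bullet> \<psi> g z) = (\<Sum>g\<in>S. - (a \<bullet> L g z)) + (\<Sum>g\<in>S. b - a \<bullet> v g)" for z
    by (simp add: \<psi> inner_add_right flip: sum.distrib) (intro sum.cong; simp add: \<psi> inner_add_right)
  ultimately show ?thesis
    unfolding affine_map_def by blast
qed

text \<open>Membership in an affine set is tested on weights attached to distinct points, whereas
  \<open>s\<close> may repeat values; so \<open>u\<close> collects the weights of all indices with
  the same value.\<close>

lemma affine_sum_mem:
  fixes s :: "'i \<Rightarrow> 'a::real_vector"
  assumes "finite A" "affine V" "sum c A = 1" and s: "\<And>x. x \<in> A \<Longrightarrow> s x \<in> V"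
  shows "(\<Sum>x\<in>A. c x *\<^sub>R s x) \<in> V"
proof -
  define u where "u v = (\<Sum>x | x \<in> A \<and> s x = v. c x)" for v
  have "(\<Sum>x\<in>A. c x *\<^sub>R s x) = (\<Sum>v\<in>s ` A. \<Sum>x | x \<in> A \<and> s x = v. c x *\<^sub>R s x)"
    by (rule sum.image_gen[OF assms(1)])
  also have "\<dots> = (\<Sum>v\<in>s ` A. u v *\<^sub>R v)"
    by (simp add: u_def scaleR_sum_left)
  finally have "(\<Sum>x\<in>A. c x *\<^sub>R s x) = (\<Sum>v\<in>s ` A. u v *\<^sub>R v)" .
  moreover have "sum u (s ` A) = 1"
    using sum.image_gen[OF assms(1), of c s] assms(3) by (simp add: u_def)
  moreover have "s ` A \<noteq> {}"
    using assms(3) by force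
  ultimately show ?thesis
    using assms(1,2) s unfolding affine by (metis finite_imageI image_subsetI)
qed

text \<open>The segment from a relative interior point \<open>z\<close> to a point \<open>y\<close>
  outside \<open>Q\<close> leaves \<open>Q\<close> through some facet \<open>j\<close>. An affine
  function that is positive at \<open>z\<close> and zero at the exit point is negative at
  \<open>y\<close>. The function need not be a given slack of \<open>j\<close>, which leaves room
  for averaging.\<close>

lemma mem_polytope_by_facets:
  fixes Q :: "'a::euclidean_space set"
  assumes Q: "polytope Q" "Q \<noteq> {}" and y: "y \<in> affine hull Q"
    and facets: "\<And>j. j facet_of Q \<Longrightarrow>
      \<exists>f::'a \<Rightarrow> real. affine_map f \<and> (\<forall>z\<in>j. f z = 0) \<and> (\<forall>z\<in>Q - j. f z > 0) \<and> f y \<ge> 0"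
  shows "y \<in> Q"
proof (rule ccontr)
  assume "y \<notin> Q"
  have poly: "polyhedron Q" and conv: "convex Q" and bdd: "bounded Q" and cl: "closed Q"
    using Q(1) by (auto simp: polytope_imp_polyhedron polytope_imp_convex polytope_imp_bounded
        polytope_imp_closed)
  obtain z where z: "z \<in> rel_interior Q"
    using rel_interior_eq_empty[OF conv] Q(2) by blast
  then have "z \<in> Q"
    using rel_interior_subset by blast
  then have "y - z \<noteq> 0"
    using \<open>y \<notin> Q\<close> by auto
  then obtain d where "d > 0" and w: "z + d *\<^sub>R (y - z) \<in> rel_frontier Q"
    and ray: "\<And>e. \<lbrakk>0 \<le> e; e < d\<rbrakk> \<Longrightarrow> z + e *\<^sub>R (y - z) \<in> rel_interior Q"
    using ray_to_rel_frontier[OF bdd z, of "y - z"] y by auto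
  \<comment> \<open>\<open>d\<close> is the exit parameter: \<open>d > 1\<close> would put
    \<open>y\<close> into the relative interior, and \<open>d = 1\<close> into the closed set
    \<open>Q\<close>.\<close>
  have "d \<le> 1"
    using ray[of 1] \<open>y \<notin> Q\<close> rel_interior_subset by force
  moreover have "d \<noteq> 1"
    using w \<open>y \<notin> Q\<close> cl by (auto simp: rel_frontier_def)
  ultimately have "d < 1"
    by simp
  obtain j where j: "j facet_of Q" "z + d *\<^sub>R (y - z) \<in> j"
    using w rel_frontier_of_polyhedron[OF poly] by auto
  have "z \<notin> j"
    using z j(1) rel_boundary_of_polyhedron[OF poly] by blast
  obtain f :: "'a \<Rightarrow> real" where f: "affine_map f" "\<forall>x\<in>j. f x = 0" "\<forall>x\<in>Q - j. f x > 0" "f y \<ge> 0"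
    using facets[OF j(1)] by blast
  have "0 = (1 - d) * f z + d * f y"
    using affine_map_line[OF f(1), of z d y] f(2) j(2) by simp
  moreover have "(1 - d) * f z > 0"
    using f(3) \<open>d < 1\<close> \<open>z \<in> Q\<close> \<open>z \<notin> j\<close> by simp
  moreover have "d * f y \<ge> 0"
    using f(4) \<open>d > 0\<close> by simp
  ultimately show False
    by linarith
qed

section \<open>Averaging over a finite group\<close>

lemma sum_comp_mult_right:
  assumes "subgroup S G" "group G" "h \<in> S"
  shows "(\<Sum>g\<in>S. F (g \<otimes>\<^bsub>G\<^esub> h)) = (\<Sum>g\<in>S. F g)"
proof -
  interpret group G by fact
  interpret subgroup S G by fact
  have "h \<in> carrier G"
    using assms(3) subset by blast
  then show ?thesis
    by (intro sum.reindex_bij_witness[where i = "\<lambda>g. g \<otimes>\<^bsub>G\<^esub> inv\<^bsub>G\<^esub> h" and j = "\<lambda>g. g \<otimes>\<^bsub>G\<^esub> h"])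
      (auto simp: m_assoc assms(3))
qed

text \<open>Start from any choice \<open>t\<close> of preimages and average
  \<open>\<psi> (inv g) (t (\<phi> g x))\<close> over \<open>g\<close>. Each term lies over
  \<open>x\<close> because \<open>p\<close> commutes with the action, and convexity keeps the
  average in \<open>Q\<close>. The result is a map of sets that need not be affine.\<close>

lemma equivariant_section:
  assumes "group G" and fin: "finite (carrier G)"
    and \<phi>: "affine_action G \<phi>" and \<psi>: "affine_action G \<psi>"
    and ext: "symmetric_extension G \<phi> P \<psi> Q p"
  obtains s where "\<And>x. x \<in> P \<Longrightarrow> s x \<in> Q" "\<And>x. x \<in> P \<Longrightarrow> p (s x) = x"
    "\<And>g x. \<lbrakk>g \<in> carrier G; x \<in> P\<rbrakk> \<Longrightarrow> s (\<phi> g x) = \<psi> g (s x)"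
proof -
  interpret group G by fact
  interpret P: group_action G UNIV \<phi>
    using \<phi> by (simp add: affine_action_def)
  interpret Q: group_action G UNIV \<psi>
    using \<psi> by (simp add: affine_action_def)
  have p: "linear p" "p ` Q = P"
    and equi: "\<And>g x. \<lbrakk>g \<in> carrier G; x \<in> Q\<rbrakk> \<Longrightarrow> \<phi> g (p x) = p (\<psi> g x)"
    and GP: "G_polytope G \<phi> P" and GQ: "G_polytope G \<psi> Q"
    using ext unfolding symmetric_extension_def by blast+
  have P_closed: "\<phi> g x \<in> P" if "g \<in> carrier G" "x \<in> P" for g x
    using GP that unfolding G_polytope_def by blast
  have Q_closed: "\<psi> g x \<in> Q" if "g \<in> carrier G" "x \<in> Q" for g x
    using GQ that unfolding G_polytope_def by blast
  have "convex Q"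
    using GQ polytope_imp_convex unfolding G_polytope_def by blast
  define n where "n = real (card (carrier G))"
  have "n > 0"
    using fin one_closed by (auto simp: n_def card_gt_0_iff)
  then have sum1: "(\<Sum>g\<in>carrier G. 1 / n) = 1"
    by (simp add: n_def)
  define t where "t x = (SOME z. z \<in> Q \<and> p z = x)" for x
  have t: "t x \<in> Q" "p (t x) = x" if "x \<in> P" for x
    using someI_ex[of "\<lambda>z. z \<in> Q \<and> p z = x"] p(2) that unfolding t_def by blast+
  define s where "s x = (\<Sum>g\<in>carrier G. (1 / n) *\<^sub>R \<psi> (inv\<^bsub>G\<^esub> g) (t (\<phi> g x)))" for x
  show thesis
  proof
    show "s x \<in> Q" if "x \<in> P" for x
      unfolding s_def using \<open>n > 0\<close> sum1 that
      by (intro convex_sum[OF fin \<open>convex Q\<close>]) (auto intro!: Q_closed P_closed t(1))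
    show "p (s x) = x" if "x \<in> P" for x
    proof -
      have "p (\<psi> (inv\<^bsub>G\<^esub> g) (t (\<phi> g x))) = x" if "g \<in> carrier G" for g
      proof -
        have "p (\<psi> (inv\<^bsub>G\<^esub> g) (t (\<phi> g x))) = \<phi> (inv\<^bsub>G\<^esub> g) (\<phi> g x)"
          using equi[of "inv\<^bsub>G\<^esub> g" "t (\<phi> g x)"] t[OF P_closed[OF that \<open>x \<in> P\<close>]] that by simp
        then show ?thesis
          using P.orbit_sym_aux[OF that UNIV_I refl] by simp
      qed
      then have "p (s x) = (\<Sum>g\<in>carrier G. (1 / n) *\<^sub>R x)"
        by (simp add: s_def linear_sum[OF p(1)] linear_cmul[OF p(1)])
      also have "\<dots> = (\<Sum>g\<in>carrier G. 1 / n) *\<^sub>R x"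
        by (rule scaleR_sum_left[symmetric])
      finally show ?thesis
        by (simp only: sum1 scaleR_one)
    qed
    show "s (\<phi> h x) = \<psi> h (s x)" if h: "h \<in> carrier G" and "x \<in> P" for h x
    proof -
      \<comment> \<open>After replacing \<open>g\<close> by \<open>g \<otimes> h\<close>, the factor
        from \<open>\<psi> h\<close> cancels and \<open>\<phi> g x\<close> becomes
        \<open>\<phi> g (\<phi> h x)\<close>, which gives the terms of
        \<open>s (\<phi> h x)\<close>.\<close>
      have cancel: "h \<otimes>\<^bsub>G\<^esub> inv\<^bsub>G\<^esub> (g \<otimes>\<^bsub>G\<^esub> h) = inv\<^bsub>G\<^esub> g" if "g \<in> carrier G" for g
        using m_assoc[of h "inv\<^bsub>G\<^esub> h" "inv\<^bsub>G\<^esub> g", symmetric] h that by (simp add: inv_mult_group)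
      have "affine_map (\<psi> h)"
        using \<psi> h by (simp add: affine_action_def)
      then have "\<psi> h (s x) = (\<Sum>g\<in>carrier G. (1 / n) *\<^sub>R \<psi> h (\<psi> (inv\<^bsub>G\<^esub> g) (t (\<phi> g x))))"
        unfolding s_def by (rule affine_map_affine_combination[OF _ sum1])
      also have "\<dots> = (\<Sum>g\<in>carrier G. (1 / n) *\<^sub>R \<psi> (h \<otimes>\<^bsub>G\<^esub> inv\<^bsub>G\<^esub> g) (t (\<phi> g x)))"
        using h by (intro sum.cong refl) (simp add: Q.composition_rule)
      also have "\<dots> = (\<Sum>g\<in>carrier G. (1 / n) *\<^sub>R \<psi> (h \<otimes>\<^bsub>G\<^esub> inv\<^bsub>G\<^esub> (g \<otimes>\<^bsub>G\<^esub> h)) (t (\<phi> (g \<otimes>\<^bsub>G\<^esub> h) x)))"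
        by (rule sum_comp_mult_right[OF subgroup_self \<open>group G\<close> h, symmetric])
      also have "\<dots> = s (\<phi> h x)"
        unfolding s_def using h
        by (intro sum.cong refl) (simp add: P.composition_rule cancel)
      finally show ?thesis
        by simp
    qed
  qed
qed

text \<open>Sum the slack \<open>b - a \<bullet> \<psi> g z\<close> over the stabilizer: its
  elements preserve \<open>j\<close> and \<open>Q\<close>, so all terms vanish on \<open>j\<close>
  and are nonnegative on \<open>Q\<close>, and the term of the neutral element is strictly positive
  on \<open>Q - j\<close>. Right translation permutes the stabilizer, hence the invariance. Dividing
  by its order would change neither signs nor invariance.\<close>

lemma invariant_slack:
  fixes Q :: "'a::euclidean_space set"
  assumes "group G" "finite (carrier G)" and \<psi>: "affine_action G \<psi>" and Q: "G_polytope G \<psi> Q"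
    and j: "j facet_of Q"
  obtains f :: "'a \<Rightarrow> real" where "affine_map f" "\<forall>z\<in>j. f z = 0" "\<forall>z\<in>Q - j. f z > 0"
    "\<And>h z. h \<in> facet_stabilizer G \<psi> j \<Longrightarrow> f (\<psi> h z) = f z"
proof -
  interpret group G by fact
  interpret group_action G UNIV \<psi>
    using \<psi> by (simp add: affine_action_def)
  have poly: "polyhedron Q" and GQ: "\<And>g x. \<lbrakk>g \<in> carrier G; x \<in> Q\<rbrakk> \<Longrightarrow> \<psi> g x \<in> Q"
    using Q by (auto simp: G_polytope_def polytope_imp_polyhedron)
  \<comment> \<open>Faces of a polyhedron are exposed, so some valid inequality is tight on
    \<open>Q\<close> exactly along \<open>j\<close>.\<close>
  have "j exposed_face_of Q"
    using j exposed_face_of_polyhedron[OF poly] facet_of_imp_face_of by blast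
  then obtain a b where le: "\<And>z. z \<in> Q \<Longrightarrow> a \<bullet> z \<le> b" and j_eq: "j = Q \<inter> {z. a \<bullet> z = b}"
    unfolding exposed_face_of_def by blast
  define S where "S = facet_stabilizer G \<psi> j"
  have S: "g \<in> S \<longleftrightarrow> g \<in> carrier G \<and> \<psi> g ` j = j" for g
    by (simp add: S_def facet_stabilizer_def stabilizer_def)
  then have "S \<subseteq> carrier G"
    by blast
  then have "finite S"
    using \<open>finite (carrier G)\<close> finite_subset by blast
  have comp: "\<psi> (g \<otimes>\<^bsub>G\<^esub> h) z = \<psi> g (\<psi> h z)" if "g \<in> carrier G" "h \<in> carrier G" for g h z
    using composition_rule that by simp
  have one: "\<psi> \<one>\<^bsub>G\<^esub> z = z" for z
    using id_eq_one by (metis UNIV_I restrict_apply)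
  have "\<one>\<^bsub>G\<^esub> \<in> S"
    by (simp add: S one)
  have sub: "subgroup S G"
  proof (rule subgroupI)
    show "S \<noteq> {}"
      using \<open>\<one>\<^bsub>G\<^esub> \<in> S\<close> by blast
    show "inv\<^bsub>G\<^esub> g \<in> S" if "g \<in> S" for g
    proof -
      have "\<psi> (inv\<^bsub>G\<^esub> g) ` \<psi> g ` j = j"
        unfolding image_image using that orbit_sym_aux[OF _ UNIV_I refl] S by simp
      then show ?thesis
        using that by (simp add: S)
    qed
    show "g \<otimes>\<^bsub>G\<^esub> h \<in> S" if "g \<in> S" "h \<in> S" for g h
    proof -
      have "\<psi> (g \<otimes>\<^bsub>G\<^esub> h) ` j = \<psi> g ` \<psi> h ` j"
        unfolding image_image using that S comp by simp
      then show ?thesis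
        using that by (simp add: S)
    qed
  qed fact
  define f where "f z = (\<Sum>g\<in>S. b - a \<bullet> \<psi> g z)" for z
  show thesis
  proof
    show "affine_map f"
      unfolding f_def using \<psi> \<open>S \<subseteq> carrier G\<close>
      by (intro affine_map_sum_slack) (auto simp: affine_action_def)
    show "\<forall>z\<in>j. f z = 0"
    proof
      fix z assume "z \<in> j"
      then have "\<psi> g z \<in> j" if "g \<in> S" for g
        using that S by blast
      then show "f z = 0"
        by (simp add: f_def j_eq)
    qed
    show "\<forall>z\<in>Q - j. f z > 0"
    proof
      fix z assume z: "z \<in> Q - j"
      have "b - a \<bullet> \<psi> \<one>\<^bsub>G\<^esub> z > 0"
        using z le[of z] by (auto simp: one j_eq)
      moreover have "b - a \<bullet> \<psi> g z \<ge> 0" if "g \<in> S" for g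
        using le GQ z that S by simp
      ultimately show "f z > 0"
        unfolding f_def using \<open>finite S\<close> \<open>\<one>\<^bsub>G\<^esub> \<in> S\<close> by (intro sum_pos2) auto
    qed
    show "f (\<psi> h z) = f z" if "h \<in> facet_stabilizer G \<psi> j" for h z
    proof -
      have h: "h \<in> S"
        using that by (simp add: S_def)
      have "f (\<psi> h z) = (\<Sum>g\<in>S. b - a \<bullet> \<psi> (g \<otimes>\<^bsub>G\<^esub> h) z)"
        unfolding f_def using h by (intro sum.cong refl) (simp add: S comp)
      also have "\<dots> = f z"
        unfolding f_def by (rule sum_comp_mult_right[OF sub \<open>group G\<close> h])
      finally show ?thesis .
    qed
  qed
qed

section \<open>Block sums and the lifted combination\<close>

lemma weighted_sum_nonneg_by_blocks:
  fixes c f :: "'a \<Rightarrow> real"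
  assumes "finite X" "partition_on X \<A>"
    and nonneg: "\<And>F. F \<in> \<A> \<Longrightarrow> sum c F \<ge> 0"
    and const: "\<And>F. F \<in> \<A> \<Longrightarrow> \<exists>v\<ge>0. \<forall>x\<in>F. f x = v"
  shows "(\<Sum>x\<in>X. c x * f x) \<ge> 0"
proof -
  have "(\<Sum>x\<in>X. c x * f x) = (\<Sum>F\<in>\<A>. \<Sum>x\<in>F. c x * f x)"
    using assms(1,2) by (rule sum.partition)
  also have "\<dots> \<ge> 0"
  proof (rule sum_nonneg)
    fix F assume F: "F \<in> \<A>"
    then obtain v where "v \<ge> 0" "\<forall>x\<in>F. f x = v"
      using const by blast
    \<comment> \<open>Single coefficients may be negative; as \<open>f\<close> is constant on
      \<open>F\<close>, only their sum matters.\<close>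
    then have "(\<Sum>x\<in>F. c x * f x) = sum c F * v"
      by (simp add: sum_distrib_right)
    then show "(\<Sum>x\<in>F. c x * f x) \<ge> 0"
      using nonneg[OF F] \<open>v \<ge> 0\<close> by simp
  qed
  finally show ?thesis .
qed

theorem theorem5p1:
  fixes G :: "('g, 'r) monoid_scheme"
    and \<phi> :: "'g \<Rightarrow> real ^ 'm \<Rightarrow> real ^ 'm"
    and \<psi> :: "'g \<Rightarrow> real ^ 'd \<Rightarrow> real ^ 'd"
    and P :: "(real ^ 'm) set"
    and Q :: "(real ^ 'd) set"
    and p :: "real ^ 'd \<Rightarrow> real ^ 'm"
    and \<F> :: "(real ^ 'd) set \<Rightarrow> (real ^ 'm) set set"
    and c :: "real ^ 'm \<Rightarrow> real"
  assumes "group G" and "finite (carrier G)"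
    and "affine_action G \<phi>" and "affine_action G \<psi>"
    and "G_polytope G \<phi> P" and "G_polytope G \<psi> Q"
    and "symmetric_extension G \<phi> P \<psi> Q p"
    and "\<And>j. j facet_of Q \<Longrightarrow>
           refines (vertices P) (\<F> j)
             (orbits (G\<lparr>carrier := facet_stabilizer G \<psi> j\<rparr>) (vertices P) \<phi>)"
    and "(\<Sum>x\<in>vertices P. c x) = 1"
    and "\<And>j F. j facet_of Q \<Longrightarrow> F \<in> \<F> j \<Longrightarrow> (\<Sum>x\<in>F. c x) \<ge> 0"
  shows "(\<Sum>x\<in>vertices P. c x *\<^sub>R x) \<in> P"
proof -
  let ?X = "vertices P"
  obtain s where s: "\<And>x. x \<in> P \<Longrightarrow> s x \<in> Q" "\<And>x. x \<in> P \<Longrightarrow> p (s x) = x"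
    "\<And>g x. \<lbrakk>g \<in> carrier G; x \<in> P\<rbrakk> \<Longrightarrow> s (\<phi> g x) = \<psi> g (s x)"
    using equivariant_section[OF assms(1-4,7)] by metis
  have p: "linear p" "p ` Q = P" and "polytope P" "polytope Q"
    using assms(7) by (auto simp: symmetric_extension_def G_polytope_def)
  have X: "?X \<subseteq> P"
    by (auto simp: vertices_def extreme_point_of_def)
  have "finite ?X"
    using finite_polyhedron_extreme_points[OF polytope_imp_polyhedron[OF \<open>polytope P\<close>]]
    by (simp add: vertices_def)
  \<comment> \<open>An empty sum of coefficients would be 0, not 1.\<close>
  have "?X \<noteq> {}"
    using assms(9) by force
  then have "Q \<noteq> {}"
    using X p(2) by blast
  \<comment> \<open>\<open>y\<close> lifts the given combination along \<open>p\<close>.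
    Coefficients may be negative, so convexity alone does not give \<open>y \<in> Q\<close>; instead
    \<open>y\<close> is tested against the facets.\<close>
  define y where "y = (\<Sum>x\<in>?X. c x *\<^sub>R s x)"
  have "y \<in> affine hull Q"
    unfolding y_def
  proof (rule affine_sum_mem[OF \<open>finite ?X\<close> affine_affine_hull assms(9)])
    show "s x \<in> affine hull Q" if "x \<in> ?X" for x
      using s(1) X that by (auto intro: hull_inc)
  qed
  moreover have "\<exists>f::real ^ 'd \<Rightarrow> real.
      affine_map f \<and> (\<forall>z\<in>j. f z = 0) \<and> (\<forall>z\<in>Q - j. f z > 0) \<and> f y \<ge> 0"
    if j: "j facet_of Q" for j
  proof -
    obtain f :: "real ^ 'd \<Rightarrow> real"
      where f: "affine_map f" "\<forall>z\<in>j. f z = 0" "\<forall>z\<in>Q - j. f z > 0"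
        and inv: "\<And>h z. h \<in> facet_stabilizer G \<psi> j \<Longrightarrow> f (\<psi> h z) = f z"
      using invariant_slack[OF assms(1,2,4,6) j] by metis
    \<comment> \<open>An affine \<open>f\<close> commutes with this combination because the
      coefficients sum to 1.\<close>
    have "f y = (\<Sum>x\<in>?X. c x * f (s x))"
      using affine_map_affine_combination[OF f(1) assms(9)] by (simp add: y_def)
    also have "\<dots> \<ge> 0"
    proof (rule weighted_sum_nonneg_by_blocks[OF \<open>finite ?X\<close>])
      show "partition_on ?X (\<F> j)"
        using assms(8)[OF j] by (simp add: refines_def)
      show "sum c F \<ge> 0" if "F \<in> \<F> j" for F
        using assms(10)[OF j that] .
      show "\<exists>v\<ge>0. \<forall>x\<in>F. f (s x) = v" if F: "F \<in> \<F> j" for F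
      proof -
        \<comment> \<open>\<open>F\<close> lies in the stabilizer orbit of a vertex
          \<open>x\<close>. Equivariance of \<open>s\<close> turns moving \<open>x\<close> into
          moving \<open>s x\<close>, under which \<open>f\<close> is invariant, so
          \<open>f (s x)\<close> is the common value on \<open>F\<close>.\<close>
        obtain x where x: "x \<in> ?X"
          and orb: "F \<subseteq> orbit (G\<lparr>carrier := facet_stabilizer G \<psi> j\<rparr>) \<phi> x"
          using assms(8)[OF j] F unfolding refines_def orbits_def by blast
        have "x \<in> P"
          using x X by blast
        have "f (s x') = f (s x)" if x': "x' \<in> F" for x'
        proof -
          obtain g where g: "g \<in> facet_stabilizer G \<psi> j" "x' = \<phi> g x"
            using orb x' by (auto simp: orbit_def)
          then have "g \<in> carrier G"
            by (simp add: facet_stabilizer_def stabilizer_def)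
          then show ?thesis
            using g inv s(3) \<open>x \<in> P\<close> by simp
        qed
        \<comment> \<open>The point \<open>s x\<close> is in \<open>Q\<close>, where
          \<open>f\<close> is zero on \<open>j\<close> and positive elsewhere.\<close>
        moreover have "f (s x) \<ge> 0"
          using f(2,3) s(1)[OF \<open>x \<in> P\<close>] by (metis DiffI less_eq_real_def order_refl)
        ultimately show ?thesis
          by blast
      qed
    qed
    finally show ?thesis
      using f by blast
  qed
  ultimately have "y \<in> Q"
    by (intro mem_polytope_by_facets[OF \<open>polytope Q\<close> \<open>Q \<noteq> {}\<close>])
  moreover have "p y = (\<Sum>x\<in>?X. c x *\<^sub>R x)"
    using s(2) X by (auto simp: y_def linear_sum[OF p(1)] linear_cmul[OF p(1)] intro!: sum.cong)
  ultimately show ?thesis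
    using p(2) by (metis image_eqI)
qed

end
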